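(* In ZFC, there is a (non-empty) perfect compact zero-dimensional Hausdorff space $X$ with 2DCP which is not locally homogeneous and which contains no copy of $\beta\omega$ and no copy of $2^\omega$.
   Context: A Tychonoff space $X$ has the two-disjoint-copies property (2DCP) if there is a sequence $(K_n)_{n\in\omega}$ of non-empty compact subsets of $X$ such that each $K_n$ contains two disjoint subsets homeomorphic to $K_{n+1}$. A space $X$ is locally homogeneous if for all $x,y\in X$ there are open neighbourhoods $U$ of $x$ and $V$ of $y$ and a homeomorphism $\varphi:U\to V$ with $\varphi(x)=y$. Perfect means without isolated points. "Contains a copy of $Y$" means that some subspace is homeomorphic to $Y$; $2^\omega$ is the Cantor set and $\beta\omega$ is the Čech–Stone compactification of the discrete space $\omega$. *)

theory Defs
  imports "HOL-Analysis.Analysis"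
begin

definition contains_copy_of :: "'a topology \<Rightarrow> 'b topology \<Rightarrow> bool" where
  "contains_copy_of X Y \<longleftrightarrow>
     (\<exists>S \<subseteq> topspace X. subtopology X S homeomorphic_space Y)"

definition tychonoff_space :: "'a topology \<Rightarrow> bool" where
  "tychonoff_space X \<longleftrightarrow> completely_regular_space X \<and> Hausdorff_space X"

definition two_disjoint_copies_property :: "'a topology \<Rightarrow> bool" where
  "two_disjoint_copies_property X \<longleftrightarrow>
     tychonoff_space X \<and>
     (\<exists>K :: nat \<Rightarrow> 'a set.
        (\<forall>n. compactin X (K n) \<and> K n \<noteq> {}) \<and>
        (\<forall>n. \<exists>A B. A \<subseteq> K n \<and> B \<subseteq> K n \<and> disjnt A B \<and>
               subtopology X A homeomorphic_space subtopology X (K (Suc n)) \<and>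
               subtopology X B homeomorphic_space subtopology X (K (Suc n))))"

definition locally_homogeneous_space :: "'a topology \<Rightarrow> bool" where
  "locally_homogeneous_space X \<longleftrightarrow>
     (\<forall>x \<in> topspace X. \<forall>y \<in> topspace X.
        \<exists>U V \<phi>. openin X U \<and> x \<in> U \<and> openin X V \<and> y \<in> V \<and>
          homeomorphic_map (subtopology X U) (subtopology X V) \<phi> \<and> \<phi> x = y)"

definition without_isolated_points :: "'a topology \<Rightarrow> bool" where
  "without_isolated_points X \<longleftrightarrow> (\<forall>x \<in> topspace X. \<not> openin X {x})"

definition zero_dimensional_space :: "'a topology \<Rightarrow> bool" where
  "zero_dimensional_space X \<longleftrightarrow>
     openin X = arbitrary union_of (\<lambda>B. openin X B \<and> closedin X B)"

definition cantor_set :: "(nat \<Rightarrow> bool) topology" where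
  "cantor_set = product_topology (\<lambda>_. discrete_topology UNIV) UNIV"

text \<open>
  The Cech-Stone compactification of a Tychonoff space \<open>X\<close>, as the closure of the image of \<open>X\<close>
  under the evaluation map into the cube indexed by all continuous maps from \<open>X\<close> to \<open>[0,1]\<close>.
  Maps are taken extensional so that each continuous map on \<open>topspace X\<close> is listed once.
\<close>

definition unit_interval_maps :: "'a topology \<Rightarrow> ('a \<Rightarrow> real) set" where
  "unit_interval_maps X =
     {f \<in> extensional (topspace X). continuous_map X (top_of_set {0..1}) f}"

definition evaluation_cube :: "'a topology \<Rightarrow> (('a \<Rightarrow> real) \<Rightarrow> real) topology" where
  "evaluation_cube X = product_topology (\<lambda>_. top_of_set {0..1}) (unit_interval_maps X)"

definition evaluation_map :: "'a topology \<Rightarrow> 'a \<Rightarrow> (('a \<Rightarrow> real) \<Rightarrow> real)" where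
  "evaluation_map X x = (\<lambda>f \<in> unit_interval_maps X. f x)"

definition cech_stone :: "'a topology \<Rightarrow> (('a \<Rightarrow> real) \<Rightarrow> real) topology" where
  "cech_stone X =
     subtopology (evaluation_cube X)
       (evaluation_cube X closure_of (evaluation_map X ` topspace X))"

definition beta_omega :: "((nat \<Rightarrow> real) \<Rightarrow> real) topology" where
  "beta_omega = cech_stone (discrete_topology (UNIV :: nat set))"

end

theory Submission
  imports Defs
begin

text \<open>
  The example is the product of the split interval with the one-point compactification of a discrete
  space of size continuum. As a closed subspace of the Cantor cube of weight continuum, it
  consists of the predicates on the reals that are monotone on the open unit interval and
  hold for at most one point outside it. The split interval contains two disjoint copies of itself.
  Some points are \<open>G\<^sub>\<delta>\<close> and others, lying over infinity, are not, although this property is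
  invariant under local homeomorphisms. Every second countable subspace is
  countable, which excludes the Cantor set, and every sequence has a convergent subsequence,
  whereas the integers have no convergent subsequence in \<open>\<beta>\<omega>\<close>.
\<close>

section \<open>Cuts of the unit interval and the example space\<close>

abbreviation (input) unit_ivl :: "real set" where
  "unit_ivl \<equiv> {0<..<1}"

text \<open>One index set serves both factors, so that the product is a set of predicates. On
  \<open>unit_ivl\<close> a member is an up-set, that is, a cut: each interior s carries the two
  cuts [s,1) and (s,1), and the empty and full cuts are the end points. On the complement it is the
  indicator of a single point or constantly false; the latter is the point at infinity.\<close>

definition example_carrier :: "(real \<Rightarrow> bool) set" where
  "example_carrier =
     {f. (\<forall>x\<in>unit_ivl. \<forall>y\<in>unit_ivl. x < y \<longrightarrow> f x \<longrightarrow> f y) \<and>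
         (\<forall>x\<in>-unit_ivl. \<forall>y\<in>-unit_ivl. f x \<longrightarrow> f y \<longrightarrow> x = y)}"

text \<open>The slice of the product over the point at infinity.\<close>

definition split_interval :: "(real \<Rightarrow> bool) set" where
  "split_interval =
     {f. (\<forall>x\<in>unit_ivl. \<forall>y\<in>unit_ivl. x < y \<longrightarrow> f x \<longrightarrow> f y) \<and> (\<forall>x\<in>-unit_ivl. \<not> f x)}"

lemma split_interval_subset: "split_interval \<subseteq> example_carrier"
  unfolding split_interval_def example_carrier_def by blast

section \<open>Cubes of Booleans\<close>

lemma discrete_bool_eq_euclidean: "discrete_topology (UNIV :: bool set) = euclidean"
  by (metis discrete_topology_unique open_discrete open_openin topspace_euclidean)

lemma cantor_set_eq_euclidean: "cantor_set = euclidean"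
  unfolding cantor_set_def discrete_bool_eq_euclidean euclidean_product_topology ..

lemma open_coordinate: "open {f :: 'a \<Rightarrow> bool. P (f x)}"
proof -
  have "open ((\<lambda>f :: 'a \<Rightarrow> bool. f x) -` Collect P)"
    by (intro open_vimage open_discrete continuous_on_product_coordinates)
  then show ?thesis
    by (simp add: vimage_def)
qed

lemma closed_coordinate: "closed {f :: 'a \<Rightarrow> bool. P (f x)}"
  using open_coordinate[of "\<lambda>b. \<not> P b" x] by (simp add: closed_def Collect_neg_eq)

lemma continuous_on_coordinate: "continuous_on S (\<lambda>f :: 'a \<Rightarrow> bool. P (f x) :: bool)"
proof (rule continuous_on_compose2[of UNIV P])
  have "\<exists>A. open A \<and> A \<inter> UNIV = P -` B \<inter> UNIV" for B
    by (intro exI[of _ "P -` B"] conjI open_discrete refl)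
  then show "continuous_on UNIV P"
    unfolding continuous_on_open_invariant by blast
qed (auto intro: continuous_on_subset[OF continuous_on_product_coordinates])

lemma open_cylinder:
  fixes f :: "'a \<Rightarrow> bool"
  assumes "finite F"
  shows "open {g. \<forall>x\<in>F. g x = f x}"
proof -
  have "{g. \<forall>x\<in>F. g x = f x} = (\<Inter>x\<in>F. {g. g x = f x})"
    by auto
  then show ?thesis
    using assms by (auto intro!: open_INT open_coordinate)
qed

lemma closed_cylinder: "closed {g. \<forall>x\<in>F. g x = (f x :: bool)}"
  unfolding Ball_def
  by (intro closed_Collect_all closed_Collect_imp open_Collect_const closed_coordinate)

text \<open>A basic open box restricts finitely many coordinates only; fixing exactly these
  coordinates to the values of \<open>f\<close> stays inside the box.\<close>

lemma open_contains_cylinder: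
  fixes f :: "'a \<Rightarrow> bool"
  assumes "open W" "f \<in> W"
  obtains F where "finite F" "{g. \<forall>x\<in>F. g x = f x} \<subseteq> W"
proof -
  have "openin (product_topology (\<lambda>_. euclidean) UNIV) W"
    using assms(1) by (simp add: open_fun_def)
  then obtain Y where Y: "f \<in> (\<Pi>\<^sub>E i\<in>UNIV. Y i)" "finite {i. Y i \<noteq> UNIV}"
      "(\<Pi>\<^sub>E i\<in>UNIV. Y i) \<subseteq> W"
    using product_topology_open_contains_basis[of "\<lambda>_. euclidean" UNIV W f] assms(2)
    unfolding topspace_euclidean by blast
  have "{g. \<forall>x\<in>{i. Y i \<noteq> UNIV}. g x = f x} \<subseteq> (\<Pi>\<^sub>E i\<in>UNIV. Y i)"
  proof
    fix g assume "g \<in> {g. \<forall>x\<in>{i. Y i \<noteq> UNIV}. g x = f x}"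
    then have "g i \<in> Y i" for i
      using Y(1) by (cases "Y i = UNIV") auto
    then show "g \<in> (\<Pi>\<^sub>E i\<in>UNIV. Y i)"
      by auto
  qed
  with Y show thesis
    by (intro that[of "{i. Y i \<noteq> UNIV}"]) auto
qed

lemma tendsto_bool_fun_iff:
  fixes f :: "'b \<Rightarrow> 'a \<Rightarrow> bool"
  shows "(f \<longlongrightarrow> l) F \<longleftrightarrow> (\<forall>x. \<forall>\<^sub>F n in F. f n x = l x)"
proof -
  have "(f \<longlongrightarrow> l) F \<longleftrightarrow> limitin (product_topology (\<lambda>_. euclidean) UNIV) f l F"
    by (simp add: euclidean_product_topology)
  also have "\<dots> \<longleftrightarrow> (\<forall>x. \<forall>\<^sub>F n in F. f n x = l x)"
    by (simp add: limitin_componentwise tendsto_discrete)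
  finally show ?thesis .
qed

text \<open>Cylinders over finitely many coordinates are clopen, and their traces on
  \<open>S\<close> form a base.\<close>

lemma zero_dimensional_top_of_set: "zero_dimensional_space (top_of_set (S :: ('a \<Rightarrow> bool) set))"
proof -
  have "openin (top_of_set S) = arbitrary union_of (\<lambda>B. openin (top_of_set S) B \<and> closedin (top_of_set S) B)"
  proof (intro openin_topology_base_unique[THEN iffD2] conjI allI impI)
    fix U f assume U: "openin (top_of_set S) U \<and> f \<in> U"
    then obtain W where W: "open W" "U = S \<inter> W"
      by (auto simp: openin_open)
    with U have "f \<in> S" "f \<in> W"
      by auto
    then obtain F where F: "finite F" "{g. \<forall>x\<in>F. g x = f x} \<subseteq> W"
      using open_contains_cylinder[OF W(1)] by blast
    let ?B = "S \<inter> {g. \<forall>x\<in>F. g x = f x}"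
    have "openin (top_of_set S) ?B" "closedin (top_of_set S) ?B"
      by (rule openin_open_Int[OF open_cylinder[OF F(1)]], rule closedin_closed_Int[OF closed_cylinder])
    then show "\<exists>B. (openin (top_of_set S) B \<and> closedin (top_of_set S) B) \<and> f \<in> B \<and> B \<subseteq> U"
      using \<open>f \<in> S\<close> W(2) F(2) by (intro exI[of _ ?B]) blast
  qed blast
  then show ?thesis
    by (simp add: zero_dimensional_space_def)
qed

lemma Hausdorff_top_of_set: "Hausdorff_space (top_of_set (S :: ('a \<Rightarrow> bool) set))"
proof -
  have "Hausdorff_space (product_topology (\<lambda>_::'a. discrete_topology (UNIV :: bool set)) UNIV)"
    by (simp add: Hausdorff_space_product_topology)
  then show ?thesis
    by (simp add: discrete_bool_eq_euclidean euclidean_product_topology Hausdorff_space_subtopology)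
qed

lemma compact_closed_bool_fun:
  assumes "closed (S :: ('a \<Rightarrow> bool) set)"
  shows "compact S"
proof -
  have "compact_space (discrete_topology (UNIV :: bool set))"
    by (simp add: compact_space_discrete_topology)
  then have "compact_space (euclidean :: ('a \<Rightarrow> bool) topology)"
    unfolding euclidean_product_topology[symmetric] discrete_bool_eq_euclidean
    by (simp add: compact_space_product_topology)
  then have "compact (UNIV :: ('a \<Rightarrow> bool) set)"
    by (simp add: compact_space_def)
  then show ?thesis
    using assms by (metis compact_Int_closed inf_top_left)
qed

section \<open>Compactness and isolated points\<close>

text \<open>Each single instance of a defining condition involves at most two coordinates and hence
  is closed; the carrier is the intersection of all of them.\<close>

lemma closed_example_carrier: "closed example_carrier"
  unfolding example_carrier_def Ball_def
  by (intro closed_Collect_conj closed_Collect_all closed_Collect_imp closed_Collect_const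
      closed_coordinate[of "\<lambda>b. b"] closed_coordinate[of Not] open_Collect_const open_coordinate[of "\<lambda>b. b"])

lemma closed_split_interval: "closed split_interval"
  unfolding split_interval_def Ball_def
  by (intro closed_Collect_conj closed_Collect_all closed_Collect_imp closed_Collect_const
      closed_coordinate[of "\<lambda>b. b"] closed_coordinate[of Not] open_Collect_const open_coordinate[of "\<lambda>b. b"])

text \<open>Density is used twice to obtain a nondegenerate gap, inside which a cut can be moved
  without being noticed by finitely many coordinates.\<close>

lemma finite_separation:
  fixes L R :: "real set"
  assumes "finite L" "finite R" "L \<noteq> {}" "R \<noteq> {}" "\<And>l r. l \<in> L \<Longrightarrow> r \<in> R \<Longrightarrow> l < r"
  obtains u v where "u < v" "\<And>l. l \<in> L \<Longrightarrow> l < u" "\<And>r. r \<in> R \<Longrightarrow> v < r"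
proof -
  have "Max L < Min R"
    using assms by simp
  then obtain u where u: "Max L < u" "u < Min R"
    using dense by blast
  then obtain v where "u < v" "v < Min R"
    using dense by blast
  with u assms show thesis
    by (intro that[of u v]) auto
qed

text \<open>A neighbourhood of \<open>f\<close> sees a finite set \<open>F\<close> of coordinates.
  The points of \<open>F\<close> in \<open>unit_ivl\<close> where \<open>f\<close> fails lie to the
  left of those where it holds, and every cut placed in the gap between them agrees with
  \<open>f\<close> on \<open>F\<close>.\<close>

lemma without_isolated_points_example: "without_isolated_points (top_of_set example_carrier)"
  unfolding without_isolated_points_def
proof (intro ballI notI)
  fix f assume "f \<in> topspace (top_of_set example_carrier)"
    and op: "openin (top_of_set example_carrier) {f}"
  then have f: "f \<in> example_carrier"
    by simp
  from op obtain W where W: "open W" "{f} = example_carrier \<inter> W"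
    by (auto simp: openin_open)
  then have "f \<in> W"
    by blast
  then obtain F where F: "finite F" "{g. \<forall>x\<in>F. g x = f x} \<subseteq> W"
    using open_contains_cylinder[OF W(1)] by blast
  \<comment> \<open>Adjoining 0 and 1 makes both finite sets non-empty and forces \<open>u\<close>
    and \<open>v\<close> into \<open>unit_ivl\<close>.\<close>
  obtain u v where uv: "u < v"
    and L: "\<And>l. l \<in> insert 0 {x \<in> F \<inter> unit_ivl. \<not> f x} \<Longrightarrow> l < u"
    and R: "\<And>r. r \<in> insert 1 {x \<in> F \<inter> unit_ivl. f x} \<Longrightarrow> v < r"
  proof (rule finite_separation[of "insert 0 {x \<in> F \<inter> unit_ivl. \<not> f x}" "insert 1 {x \<in> F \<inter> unit_ivl. f x}"])
    fix l r assume l: "l \<in> insert 0 {x \<in> F \<inter> unit_ivl. \<not> f x}" and r: "r \<in> insert 1 {x \<in> F \<inter> unit_ivl. f x}"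
    have "l < r" if "l \<in> unit_ivl" "r \<in> unit_ivl" "\<not> f l" "f r"
    proof -
      have "\<not> r < l" "r \<noteq> l"
        using f that unfolding example_carrier_def by blast+
      then show ?thesis
        by simp
    qed
    with l r show "l < r"
      by auto
  qed (use F(1) in auto)
  \<comment> \<open>The cut is moved to \<open>w\<close>, and the part outside
    \<open>unit_ivl\<close> is kept.\<close>
  define g where "g w x = (if x \<in> unit_ivl then w \<le> x else f x)" for w x
  have g: "g w = f" if "u \<le> w" "w \<le> v" for w
  proof -
    have "g w \<in> example_carrier"
      using f unfolding example_carrier_def g_def by simp
    moreover have "g w x = f x" if "x \<in> F" for x
      using L[of x] R[of x] \<open>u \<le> w\<close> \<open>w \<le> v\<close> that by (cases "x \<in> unit_ivl"; cases "f x") (auto simp: g_def)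
    ultimately show ?thesis
      using W(2) F(2) by blast
  qed
  \<comment> \<open>Both \<open>g u\<close> and \<open>g v\<close> would have to equal
    \<open>f\<close>, but they differ at the coordinate \<open>u\<close>.\<close>
  have "g u u" "\<not> g v u"
    using uv L[of 0] R[of 1] by (auto simp: g_def)
  then show False
    using g[of u] g[of v] uv by auto
qed

section \<open>Disjoint copies of the split interval\<close>

text \<open>A cut that is false up to \<open>a\<close> and true from \<open>b\<close> on is
  determined by its values strictly between \<open>a\<close> and \<open>b\<close>, and the affine
  bijection of \<open>unit_ivl\<close> with that interval transports these values.\<close>

lemma split_interval_copy:
  fixes a b :: real
  assumes ab: "0 \<le> a" "a < b" "b \<le> 1"
  shows "{f \<in> split_interval. (\<forall>x\<in>unit_ivl. x \<le> a \<longrightarrow> \<not> f x) \<and> (\<forall>x\<in>unit_ivl. b \<le> x \<longrightarrow> f x)}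
           homeomorphic split_interval" (is "?A homeomorphic _")
proof -
  \<comment> \<open>\<open>\<phi>\<close> stretches the window between \<open>a\<close> and
    \<open>b\<close> to the whole interval; \<open>\<psi>\<close> shrinks back and fills in false up
    to \<open>a\<close> and true from \<open>b\<close> on.\<close>
  define \<phi> where "\<phi> f x = (x \<in> unit_ivl \<and> f (a + (b - a) * x))" for f :: "real \<Rightarrow> bool" and x
  define \<psi> where "\<psi> f x = (x \<in> unit_ivl \<and> a < x \<and> (b \<le> x \<or> f ((x - a) / (b - a))))"
    for f :: "real \<Rightarrow> bool" and x
  have inside: "a + (b - a) * x \<in> unit_ivl \<and> a < a + (b - a) * x \<and> a + (b - a) * x < b"
    if "x \<in> unit_ivl" for x
  proof -
    have "0 < (b - a) * x" "(b - a) * x < (b - a) * 1"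
      using that ab by (auto intro!: mult_strict_left_mono mult_pos_pos)
    moreover have "(b - a) * 1 = b - a"
      by simp
    ultimately have "a < a + (b - a) * x" "a + (b - a) * x < b"
      by linarith+
    then show ?thesis
      using ab by auto
  qed
  have scaled: "(x - a) / (b - a) \<in> unit_ivl" if "a < x" "x < b" for x
    using that by auto
  have "homeomorphism ?A split_interval \<phi> \<psi>"
  proof (rule homeomorphismI)
    \<comment> \<open>Each coordinate of the image depends on a single coordinate of
      \<open>f\<close>.\<close>
    have "continuous_on S (\<lambda>f. \<phi> f x)" "continuous_on S (\<lambda>f. \<psi> f x)" for S x
      unfolding \<phi>_def \<psi>_def by (rule continuous_on_coordinate)+
    then show "continuous_on ?A \<phi>" "continuous_on split_interval \<psi>"
      by (auto intro: continuous_on_coordinatewise_then_product)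
    show "\<phi> ` ?A \<subseteq> split_interval"
    proof clarify
      fix f assume f: "f \<in> split_interval"
      have "\<phi> f y" if "x \<in> unit_ivl" "y \<in> unit_ivl" "x < y" "\<phi> f x" for x y
      proof -
        have "a + (b - a) * x < a + (b - a) * y"
          using that ab by simp
        with that f inside[of x] inside[of y] show ?thesis
          unfolding split_interval_def \<phi>_def by blast
      qed
      then show "\<phi> f \<in> split_interval"
        by (auto simp: split_interval_def \<phi>_def)
    qed
    show "\<psi> ` split_interval \<subseteq> ?A"
    proof clarify
      fix f assume f: "f \<in> split_interval"
      have "\<psi> f y" if "x \<in> unit_ivl" "y \<in> unit_ivl" "x < y" "\<psi> f x" for x y
      proof (cases "b \<le> y")
        case False
        then have "(x - a) / (b - a) < (y - a) / (b - a)"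
          using that ab by (simp add: divide_strict_right_mono)
        moreover have "a < x" "f ((x - a) / (b - a))"
          using that False by (auto simp: \<psi>_def)
        ultimately have "f ((y - a) / (b - a))"
          using that False f scaled[of x] scaled[of y] unfolding split_interval_def by force
        with that \<open>a < x\<close> show ?thesis
          by (simp add: \<psi>_def)
      qed (use that in \<open>auto simp: \<psi>_def\<close>)
      moreover have "\<psi> f y" if "y \<in> unit_ivl" "b \<le> y" for y
        using that ab by (auto simp: \<psi>_def)
      moreover have "\<not> \<psi> f y" if "y \<notin> unit_ivl \<or> y \<le> a" for y
        using that by (auto simp: \<psi>_def)
      ultimately show "\<psi> f \<in> split_interval \<and> (\<forall>x\<in>unit_ivl. x \<le> a \<longrightarrow> \<not> \<psi> f x) \<and>
          (\<forall>x\<in>unit_ivl. b \<le> x \<longrightarrow> \<psi> f x)"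
        unfolding split_interval_def by blast
    qed
    show "\<psi> (\<phi> f) = f" if f: "f \<in> ?A" for f
    proof
      fix x
      have "a + (b - a) * ((x - a) / (b - a)) = x"
        using ab by simp
      then show "\<psi> (\<phi> f) x = f x"
        using f scaled[of x] by (cases "x \<in> unit_ivl"; cases "x \<le> a"; cases "b \<le> x")
          (auto simp: \<psi>_def \<phi>_def split_interval_def)
    qed
    show "\<phi> (\<psi> f) = f" if f: "f \<in> split_interval" for f
    proof
      fix x
      show "\<phi> (\<psi> f) x = f x"
        using f ab inside[of x] by (cases "x \<in> unit_ivl") (auto simp: \<psi>_def \<phi>_def split_interval_def)
    qed
  qed
  then show ?thesis
    unfolding homeomorphic_def by blast
qed

lemma homeomorphic_imp_homeomorphic_space:
  assumes "S homeomorphic T"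
  shows "top_of_set S homeomorphic_space top_of_set T"
proof -
  obtain f g where "homeomorphism S T f g"
    using assms unfolding homeomorphic_def by blast
  then have "homeomorphic_maps (top_of_set S) (top_of_set T) f g"
    by (force simp: homeomorphic_maps_def homeomorphism_def)
  then show ?thesis
    unfolding homeomorphic_space_def by blast
qed

lemma tychonoff_space_compact_Hausdorff:
  assumes "compact_space X" "Hausdorff_space X"
  shows "tychonoff_space X"
  using assms
  by (simp add: tychonoff_space_def compact_Hausdorff_or_regular_imp_normal_space
      normal_imp_completely_regular_space)

lemma compact_space_example: "compact_space (top_of_set example_carrier)"
  using compact_closed_bool_fun[OF closed_example_carrier] by (simp add: compact_space_subtopology)

text \<open>The constant sequence with value \<open>split_interval\<close> works: the cuts lying in
  the left and in the right half of the interval are two copies of it.\<close>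

lemma two_disjoint_copies_example: "two_disjoint_copies_property (top_of_set example_carrier)"
proof -
  let ?X = "top_of_set example_carrier"
  let ?C = "\<lambda>a b. {f \<in> split_interval. (\<forall>x\<in>unit_ivl. x \<le> a \<longrightarrow> \<not> f x) \<and> (\<forall>x\<in>unit_ivl. b \<le> x \<longrightarrow> f x)}"
  have sub: "subtopology ?X S = top_of_set S" if "S \<subseteq> split_interval" for S
    using that split_interval_subset by (simp add: subtopology_subtopology Int_absorb1)
  have copy: "subtopology ?X (?C a b) homeomorphic_space subtopology ?X split_interval"
    if "0 \<le> a" "a < b" "b \<le> 1" for a b
    using homeomorphic_imp_homeomorphic_space[OF split_interval_copy[OF that]]
    by (simp add: sub)
  have "compactin ?X split_interval"
    using compact_closed_bool_fun[OF closed_split_interval] split_interval_subset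
    by (simp add: compactin_subtopology)
  moreover have "(\<lambda>_. False) \<in> split_interval"
    by (simp add: split_interval_def)
  \<comment> \<open>The coordinate 1/2 is true throughout the first set and false throughout the
    second.\<close>
  moreover have "disjnt (?C 0 (1/2)) (?C (1/2) 1)"
  proof -
    have "(1/2 :: real) \<in> unit_ivl"
      by simp
    then show ?thesis
      unfolding disjnt_iff by blast
  qed
  moreover have "subtopology ?X (?C 0 (1/2)) homeomorphic_space subtopology ?X split_interval"
      "subtopology ?X (?C (1/2) 1) homeomorphic_space subtopology ?X split_interval"
    by (rule copy; simp)+
  ultimately show ?thesis
    unfolding two_disjoint_copies_property_def
    using tychonoff_space_compact_Hausdorff[OF compact_space_example Hausdorff_top_of_set]
    by (intro conjI exI[of _ "\<lambda>_. split_interval"] allI exI[of _ "?C 0 (1/2)"] exI[of _ "?C (1/2) 1"])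
       blast+
qed

section \<open>Failure of local homogeneity\<close>

definition gdelta_point :: "'a topology \<Rightarrow> 'a \<Rightarrow> bool" where
  "gdelta_point X x \<longleftrightarrow> (\<exists>W :: nat \<Rightarrow> 'a set. (\<forall>n. openin X (W n)) \<and> (\<Inter>n. W n) = {x})"

text \<open>The preimages of the sets \<open>V \<inter> W n\<close> are open in \<open>U\<close>,
  hence in \<open>X\<close>, and by injectivity of \<open>\<phi>\<close> on \<open>U\<close> they
  meet in \<open>x\<close> alone.\<close>

lemma gdelta_point_transfer:
  assumes hom: "homeomorphic_map (subtopology X U) (subtopology X V) \<phi>"
    and UV: "openin X U" "openin X V" "x \<in> U" "\<phi> x \<in> V"
    and y: "gdelta_point X (\<phi> x)"
  shows "gdelta_point X x"
proof -
  obtain W :: "nat \<Rightarrow> 'a set" where "\<forall>n. openin X (W n)" and W: "(\<Inter>n. W n) = {\<phi> x}"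
    using y unfolding gdelta_point_def by (elim exE conjE)
  then have op: "openin X (W n)" for n
    by simp
  have top: "topspace (subtopology X U) = U"
    using openin_subset[OF UV(1)] by auto
  have cont: "continuous_map (subtopology X U) (subtopology X V) \<phi>" and inj: "inj_on \<phi> U"
    using homeomorphic_imp_continuous_map[OF hom] homeomorphic_imp_injective_map[OF hom]
    unfolding top .
  have "openin X {z \<in> U. \<phi> z \<in> V \<inter> W n}" for n
  proof -
    have "openin (subtopology X V) (V \<inter> W n)"
      using op by (simp add: openin_subtopology_Int2)
    then have "openin (subtopology X U) {z \<in> U. \<phi> z \<in> V \<inter> W n}"
      using openin_continuous_map_preimage[OF cont] unfolding top by blast
    then show ?thesis
      using openin_open_subtopology[OF UV(1)] by blast
  qed
  moreover have "(\<Inter>n. {z \<in> U. \<phi> z \<in> V \<inter> W n}) = {x}"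
  proof -
    have "z = x" if "z \<in> U" "\<And>n. \<phi> z \<in> W n" for z
    proof -
      have "\<phi> z = \<phi> x"
        using that(2) W by blast
      then show ?thesis
        using that(1) inj UV(3) by (simp add: inj_on_eq_iff)
    qed
    moreover have "\<phi> x \<in> W n" for n
      using W by blast
    ultimately show ?thesis
      using UV(3,4) by blast
  qed
  ultimately show ?thesis
    unfolding gdelta_point_def by (intro exI[of _ "\<lambda>n. {z \<in> U. \<phi> z \<in> V \<inter> W n}"] conjI allI)
qed

text \<open>Countably many neighbourhoods of this point constrain only countably many coordinates,
  so the indicator of some other coordinate outside \<open>unit_ivl\<close> lies in all of
  them.\<close>

lemma not_gdelta_point_zero: "\<not> gdelta_point (top_of_set example_carrier) (\<lambda>_. False)"
proof
  assume "gdelta_point (top_of_set example_carrier) (\<lambda>_. False)"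
  then obtain W where W: "\<And>n::nat. openin (top_of_set example_carrier) (W n)"
      and W0: "(\<Inter>n. W n) = {\<lambda>_. False}"
    unfolding gdelta_point_def by blast
  have "\<exists>F. finite F \<and> example_carrier \<inter> {g. \<forall>x\<in>F. g x = False} \<subseteq> W n" for n
  proof -
    obtain V where V: "open V" "W n = example_carrier \<inter> V"
      using W[of n] by (auto simp: openin_open)
    have "(\<lambda>_. False) \<in> V"
      using W0 V(2) by blast
    then obtain F where "finite F" "{g. \<forall>x\<in>F. g x = False} \<subseteq> V"
      using open_contains_cylinder[OF V(1)] by blast
    with V(2) show ?thesis
      by blast
  qed
  then obtain F where F: "\<And>n. finite (F n)" "\<And>n. example_carrier \<inter> {g. \<forall>x\<in>F n. g x = False} \<subseteq> W n"
    by metis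
  have "countable (\<Union>n. F n)"
    by (simp add: F(1) uncountable_infinite[THEN contrapos_pp] countable_finite)
  \<comment> \<open>This interval is disjoint from \<open>unit_ivl\<close>, so the indicator of any
    of its points belongs to the carrier.\<close>
  moreover have "uncountable {1<..<2::real}"
    by (simp add: uncountable_open_interval)
  ultimately obtain a where a: "a \<in> {1<..<2::real}" "a \<notin> (\<Union>n. F n)"
    by (meson countable_subset subsetI)
  have "(\<lambda>x. x = a) \<in> example_carrier"
    using a(1) by (auto simp: example_carrier_def)
  moreover have "\<forall>x\<in>F n. (x = a) = False" for n
    using a(2) by blast
  ultimately have "(\<lambda>x. x = a) \<in> (\<Inter>n. W n)"
    using F(2) by blast
  then show False
    unfolding W0 by (auto simp: fun_eq_iff)
qed

text \<open>Truth at 2 fixes the part outside \<open>unit_ivl\<close>, and failure along a sequence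
  increasing to 1 makes the cut empty by monotonicity.\<close>

lemma gdelta_point_indicator: "gdelta_point (top_of_set example_carrier) (\<lambda>x. x = 2)"
proof -
  \<comment> \<open>The sequence starts at 1/2, so all its points lie in
    \<open>unit_ivl\<close>.\<close>
  let ?W = "\<lambda>n. example_carrier \<inter> ({f. f 2} \<inter> {f. \<not> f (1 - 1 / (real n + 2))})"
  have "openin (top_of_set example_carrier) (?W n)" for n
    by (intro openin_open_Int open_Int open_coordinate)
  moreover have "(\<Inter>n. ?W n) = {\<lambda>x. x = 2}"
  proof (intro equalityI subsetI)
    fix f assume "f \<in> (\<Inter>n. ?W n)"
    then have f: "f \<in> example_carrier" "f 2" and nf: "\<And>n. \<not> f (1 - 1 / (real n + 2))"
      by auto
    have "\<not> f x" if x: "x \<in> unit_ivl" for x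
    proof
      assume "f x"
      obtain n where n: "1 / (1 - x) < real n"
        using reals_Archimedean2 by blast
      then have "1 / (real n + 2) < 1 - x"
        using x by (simp add: field_simps)
      moreover have "1 - 1 / (real n + 2) \<in> unit_ivl"
        by (simp add: field_simps)
      ultimately have "f (1 - 1 / (real n + 2))"
        using f(1) x \<open>f x\<close> unfolding example_carrier_def by force
      with nf show False
        by blast
    qed
    moreover have "f x \<longleftrightarrow> x = 2" if "x \<notin> unit_ivl" for x
      using f that unfolding example_carrier_def by force
    ultimately have "f x \<longleftrightarrow> x = 2" for x
      by (cases "x \<in> unit_ivl") auto
    then show "f \<in> {\<lambda>x. x = 2}"
      by auto
  next
    fix f :: "real \<Rightarrow> bool" assume "f \<in> {\<lambda>x. x = 2}"
    moreover have "1 - 1 / (real n + 2) < 2" for n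
      by (simp add: field_simps)
    ultimately show "f \<in> (\<Inter>n. ?W n)"
      by (auto simp: example_carrier_def less_imp_neq)
  qed
  ultimately show ?thesis
    unfolding gdelta_point_def by (intro exI[of _ ?W] conjI allI)
qed

lemma not_locally_homogeneous_example: "\<not> locally_homogeneous_space (top_of_set example_carrier)"
proof
  assume hom: "locally_homogeneous_space (top_of_set example_carrier)"
  have "(\<lambda>_. False) \<in> example_carrier" "(\<lambda>x. x = 2) \<in> example_carrier"
    by (auto simp: example_carrier_def)
  with hom obtain U V \<phi> where "openin (top_of_set example_carrier) U" "(\<lambda>_. False) \<in> U"
      "openin (top_of_set example_carrier) V" "(\<lambda>x. x = 2) \<in> V"
      "homeomorphic_map (subtopology (top_of_set example_carrier) U) (subtopology (top_of_set example_carrier) V) \<phi>"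
      "\<phi> (\<lambda>_. False) = (\<lambda>x. x = 2)"
    unfolding locally_homogeneous_space_def topspace_euclidean_subtopology by metis
  then have "gdelta_point (top_of_set example_carrier) (\<lambda>_. False)"
    using gdelta_point_indicator by (metis gdelta_point_transfer)
  then show False
    using not_gdelta_point_zero by blast
qed

section \<open>No copy of the Cantor set\<close>

text \<open>The cut point is the infimum of the true points in \<open>unit_ivl\<close>. The value at
  \<open>s\<close> itself stays open: it distinguishes the two points of the split interval over
  \<open>s\<close>.\<close>

lemma example_carrier_cut:
  assumes "f \<in> example_carrier"
  obtains s where "0 \<le> s" "s \<le> 1" "\<And>x. x \<in> unit_ivl \<Longrightarrow> s < x \<Longrightarrow> f x"
    "\<And>x. x \<in> unit_ivl \<Longrightarrow> x < s \<Longrightarrow> \<not> f x"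
proof -
  \<comment> \<open>Adjoining 1 makes the set non-empty and gives the empty cut the value 1.\<close>
  let ?J = "insert 1 {x \<in> unit_ivl. f x}"
  have bdd: "bdd_below ?J"
    by (rule bdd_belowI[of _ 0]) auto
  show thesis
  proof (rule that[of "Inf ?J"])
    show "0 \<le> Inf ?J"
      by (rule cInf_greatest) auto
    show "Inf ?J \<le> 1"
      using bdd by (intro cInf_lower) auto
    show "f x" if x: "x \<in> unit_ivl" "Inf ?J < x" for x
    proof -
      obtain y where "y \<in> ?J" "y < x"
        using cInf_lessD[OF _ x(2)] by blast
      with x(1) have "y \<in> unit_ivl" "f y"
        by auto
      with \<open>y < x\<close> x(1) assms show ?thesis
        unfolding example_carrier_def by blast
    qed
    show "\<not> f x" if "x \<in> unit_ivl" "x < Inf ?J" for x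
      using that cInf_lower[OF _ bdd, of x] by auto
  qed
qed

text \<open>Here \<open>Q i p\<close> says that \<open>p\<close> is a witness for the index
  \<open>i\<close>, with neighbourhood \<open>P i\<close>. A basic set between a witness and its
  neighbourhood determines the index: if \<open>i\<close> and \<open>j\<close> share it, each
  witness lies in the neighbourhood of the other.\<close>

lemma countable_if_separated_neighbourhoods:
  assumes X: "second_countable X"
    and op: "\<And>i. i \<in> I \<Longrightarrow> \<exists>p. p \<in> P i \<and> Q i p \<and> openin X (P i)"
    and sep: "\<And>i j p q. \<lbrakk>i \<in> I; j \<in> I; Q i p; Q j q; p \<in> P j; q \<in> P i\<rbrakk> \<Longrightarrow> i = j"
  shows "countable I"
proof -
  obtain \<B> where \<B>: "countable \<B>" "\<And>U x. openin X U \<Longrightarrow> x \<in> U \<Longrightarrow> \<exists>V\<in>\<B>. x \<in> V \<and> V \<subseteq> U"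
    using X unfolding second_countable_def by metis
  have "\<exists>V p. V \<in> \<B> \<and> p \<in> V \<and> V \<subseteq> P i \<and> Q i p" if "i \<in> I" for i
    using op[OF that] \<B>(2) by blast
  then obtain V p where V: "\<And>i. i \<in> I \<Longrightarrow> V i \<in> \<B> \<and> p i \<in> V i \<and> V i \<subseteq> P i \<and> Q i (p i)"
    by metis
  have "inj_on V I"
  proof (rule inj_onI)
    fix i j assume "i \<in> I" "j \<in> I" "V i = V j"
    then show "i = j"
      using V[of i] V[of j] by (intro sep[of i j "p i" "p j"]) auto
  qed
  moreover have "countable (V ` I)"
    using V \<B>(1) by (auto intro: countable_subset)
  ultimately show ?thesis
    using countable_image_inj_on by blast
qed

text \<open>Every member is given by a cut and an outside part. Second countability leaves countably
  many choices for each, because one coordinate suffices to separate different jumps of the same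
  kind, or different outside points.\<close>

lemma second_countable_subspace_countable:
  assumes S: "S \<subseteq> example_carrier" and sc: "second_countable (top_of_set S)"
  shows "countable S"
proof -
  \<comment> \<open>\<open>I1\<close> collects the jumps of the cuts [c,1) occurring in
    \<open>S\<close>, \<open>I2\<close> those of the cuts (c,1), and \<open>I3\<close> the true
    points outside \<open>unit_ivl\<close>.\<close>
  define I1 where "I1 = {c \<in> unit_ivl. \<exists>f\<in>S. f c \<and> (\<forall>x\<in>unit_ivl. x < c \<longrightarrow> \<not> f x)}"
  define I2 where "I2 = {c \<in> unit_ivl. \<exists>f\<in>S. \<not> f c \<and> (\<forall>x\<in>unit_ivl. c < x \<longrightarrow> f x)}"
  define I3 where "I3 = {a \<in> -unit_ivl. \<exists>f\<in>S. f a}"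
  have op: "openin (top_of_set S) (S \<inter> {g. R (g c)})" for R c
    by (intro openin_open_Int open_coordinate)
  have "countable I1"
  proof (rule countable_if_separated_neighbourhoods[OF sc])
    show "\<exists>f. f \<in> S \<inter> {g. g c} \<and> (\<forall>x\<in>unit_ivl. x < c \<longrightarrow> \<not> f x) \<and> openin (top_of_set S) (S \<inter> {g. g c})"
      if "c \<in> I1" for c
      using that op[of "\<lambda>b. b" c] unfolding I1_def by blast
    show "c = d" if "c \<in> I1" "d \<in> I1" "\<forall>x\<in>unit_ivl. x < c \<longrightarrow> \<not> f x" "\<forall>x\<in>unit_ivl. x < d \<longrightarrow> \<not> g x"
      "f \<in> S \<inter> {g. g d}" "g \<in> S \<inter> {g. g c}" for c d f g
    proof -
      have "c \<in> unit_ivl" "d \<in> unit_ivl"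
        using that(1,2) by (auto simp: I1_def)
      then have "\<not> c < d" "\<not> d < c"
        using that(3-6) by blast+
      then show ?thesis
        by simp
    qed
  qed
  moreover have "countable I2"
  proof (rule countable_if_separated_neighbourhoods[OF sc])
    show "\<exists>f. f \<in> S \<inter> {g. \<not> g c} \<and> (\<forall>x\<in>unit_ivl. c < x \<longrightarrow> f x) \<and> openin (top_of_set S) (S \<inter> {g. \<not> g c})"
      if "c \<in> I2" for c
      using that op[of "\<lambda>b. \<not> b" c] unfolding I2_def by blast
    show "c = d" if "c \<in> I2" "d \<in> I2" "\<forall>x\<in>unit_ivl. c < x \<longrightarrow> f x" "\<forall>x\<in>unit_ivl. d < x \<longrightarrow> g x"
      "f \<in> S \<inter> {g. \<not> g d}" "g \<in> S \<inter> {g. \<not> g c}" for c d f g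
    proof -
      have "c \<in> unit_ivl" "d \<in> unit_ivl"
        using that(1,2) by (auto simp: I2_def)
      then have "\<not> c < d" "\<not> d < c"
        using that(3-6) by blast+
      then show ?thesis
        by simp
    qed
  qed
  moreover have "countable I3"
  proof (rule countable_if_separated_neighbourhoods[OF sc])
    show "\<exists>f. f \<in> S \<inter> {g. g a} \<and> (f \<in> S \<and> f a) \<and> openin (top_of_set S) (S \<inter> {g. g a})"
      if "a \<in> I3" for a
      using that op[of "\<lambda>b. b" a] unfolding I3_def by blast
    show "a = b" if "a \<in> I3" "b \<in> I3" "f \<in> S \<and> f a" "g \<in> S \<and> g b"
      "f \<in> S \<inter> {g. g b}" "g \<in> S \<inter> {g. g a}" for a b f g
      using that S unfolding I3_def example_carrier_def by blast
  qed
  \<comment> \<open>\<open>M\<close> contains every cut and \<open>N\<close> every outside part that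
    can occur in \<open>S\<close>; a member of \<open>S\<close> is the disjunction of one of
    each.\<close>
  moreover define M where "M = {\<lambda>_. False, \<lambda>x. x \<in> unit_ivl} \<union>
      (\<lambda>c x. x \<in> unit_ivl \<and> c \<le> x) ` I1 \<union> (\<lambda>c x. x \<in> unit_ivl \<and> c < x) ` I2"
  moreover define N where "N = {\<lambda>_. False} \<union> (\<lambda>a x. x = a) ` I3"
  ultimately have "countable ((\<lambda>(m, n) x. m x \<or> n x) ` (M \<times> N))"
    by (intro countable_image countable_SIGMA) auto
  moreover have "S \<subseteq> (\<lambda>(m, n) x. m x \<or> n x) ` (M \<times> N)"
  proof
    fix f assume fS: "f \<in> S"
    then have f: "f \<in> example_carrier"
      using S by blast
    have "\<exists>m\<in>M. \<forall>x. m x \<longleftrightarrow> x \<in> unit_ivl \<and> f x"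
    proof -
      obtain s where s: "0 \<le> s" "s \<le> 1" and up: "\<And>x. x \<in> unit_ivl \<Longrightarrow> s < x \<Longrightarrow> f x"
        and low: "\<And>x. x \<in> unit_ivl \<Longrightarrow> x < s \<Longrightarrow> \<not> f x"
        using example_carrier_cut[OF f] by blast
      \<comment> \<open>The full cut, the empty cut, and the two cuts at an interior point.\<close>
      consider "s = 0" | "s = 1" | "s \<in> unit_ivl" "f s" | "s \<in> unit_ivl" "\<not> f s"
        using s by fastforce
      then show ?thesis
      proof cases
        case 1
        then show ?thesis
          using up by (intro bexI[of _ "\<lambda>x. x \<in> unit_ivl"]) (auto simp: M_def)
      next
        case 2
        then show ?thesis
          using low by (intro bexI[of _ "\<lambda>_. False"]) (auto simp: M_def)
      next
        case 3
        then have "s \<in> I1"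
          using fS low unfolding I1_def by blast
        moreover have "s \<le> x \<longleftrightarrow> f x" if "x \<in> unit_ivl" for x
          using 3(2) up[OF that] low[OF that] by (cases x s rule: linorder_cases) auto
        ultimately show ?thesis
          by (intro bexI[of _ "\<lambda>x. x \<in> unit_ivl \<and> s \<le> x"]) (auto simp: M_def)
      next
        case 4
        then have "s \<in> I2"
          using fS up unfolding I2_def by blast
        moreover have "s < x \<longleftrightarrow> f x" if "x \<in> unit_ivl" for x
          using 4(2) up[OF that] low[OF that] by (cases x s rule: linorder_cases) auto
        ultimately show ?thesis
          by (intro bexI[of _ "\<lambda>x. x \<in> unit_ivl \<and> s < x"]) (auto simp: M_def)
      qed
    qed
    then obtain m where m: "m \<in> M" "\<And>x. m x \<longleftrightarrow> x \<in> unit_ivl \<and> f x"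
      by blast
    have "\<exists>n\<in>N. \<forall>x. n x \<longleftrightarrow> x \<notin> unit_ivl \<and> f x"
    proof (cases "\<exists>a. a \<notin> unit_ivl \<and> f a")
      case True
      then obtain a where a: "a \<notin> unit_ivl" "f a"
        by blast
      then have "a \<in> I3"
        using fS unfolding I3_def by blast
      moreover have "x = a \<longleftrightarrow> x \<notin> unit_ivl \<and> f x" for x
        using a f unfolding example_carrier_def by blast
      ultimately show ?thesis
        by (intro bexI[of _ "\<lambda>x. x = a"]) (auto simp: N_def)
    qed (auto simp: N_def)
    then obtain n where n: "n \<in> N" "\<And>x. n x \<longleftrightarrow> x \<notin> unit_ivl \<and> f x"
      by blast
    have "f = (\<lambda>(m, n) x. m x \<or> n x) (m, n)"
      using m(2) n(2) by auto
    then show "f \<in> (\<lambda>(m, n) x. m x \<or> n x) ` (M \<times> N)"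
      using m(1) n(1) by blast
  qed
  ultimately show ?thesis
    by (rule countable_subset[rotated])
qed

section \<open>Countable base and uncountability of the Cantor set\<close>

text \<open>The cylinders fixing an initial segment form a base, and they are indexed by finite
  Boolean lists.\<close>

lemma second_countable_cantor_set: "second_countable cantor_set"
  unfolding cantor_set_eq_euclidean second_countable_def open_openin[symmetric]
proof (intro exI conjI ballI allI impI)
  let ?cyl = "\<lambda>xs :: bool list. {g. \<forall>i\<in>{..<length xs}. g i = xs ! i}"
  show "countable (range ?cyl)"
    by simp
  show "open V" if "V \<in> range ?cyl" for V
    using that open_cylinder[OF finite_lessThan] by (elim imageE) (simp only:)
  show "\<exists>V\<in>range ?cyl. f \<in> V \<and> V \<subseteq> U" if Uf: "open U \<and> f \<in> U" for U f
  proof -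
    obtain F where F: "finite F" "{g. \<forall>i\<in>F. g i = f i} \<subseteq> U"
      using Uf by (elim conjE open_contains_cylinder)
    obtain n where n: "F \<subseteq> {..<n}"
      using F(1) finite_nat_iff_bounded by blast
    have "?cyl (map f [0..<n]) = {g. \<forall>i<n. g i = f i}"
      by auto
    moreover have "{g. \<forall>i<n. g i = f i} \<subseteq> U"
      using F(2) n by blast
    ultimately show ?thesis
      by (intro bexI[OF _ rangeI[of _ "map f [0..<n]"]]) simp
  qed
qed

text \<open>Cantor's diagonal argument.\<close>

lemma uncountable_nat_predicates: "uncountable (UNIV :: (nat \<Rightarrow> bool) set)"
proof
  assume "countable (UNIV :: (nat \<Rightarrow> bool) set)"
  then obtain e :: "nat \<Rightarrow> nat \<Rightarrow> bool" where "range e = UNIV"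
    by (metis UNIV_not_empty uncountable_def)
  then obtain n where "e n = (\<lambda>k. \<not> e k k)"
    by (metis UNIV_I imageE)
  then show False
    by metis
qed

lemma no_cantor_set_example: "\<not> contains_copy_of (top_of_set example_carrier) cantor_set"
proof
  assume "contains_copy_of (top_of_set example_carrier) cantor_set"
  then obtain S where S: "S \<subseteq> example_carrier"
      "subtopology (top_of_set example_carrier) S homeomorphic_space cantor_set"
    unfolding contains_copy_of_def by auto
  then have hom: "top_of_set S homeomorphic_space cantor_set"
    by (simp add: subtopology_subtopology Int_absorb1)
  then have "countable S"
    using second_countable_subspace_countable[OF S(1)] second_countable_cantor_set
      homeomorphic_space_second_countability by blast
  obtain g where "homeomorphic_map (top_of_set S) cantor_set g"
    using hom homeomorphic_space by blast
  then have "g ` S = UNIV"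
    using homeomorphic_imp_surjective_map by (fastforce simp: cantor_set_eq_euclidean)
  with \<open>countable S\<close> show False
    by (metis countable_image uncountable_nat_predicates)
qed

section \<open>Sequential compactness and \<open>\<beta>\<omega>\<close>\<close>

lemma constant_subsequence:
  fixes P :: "nat \<Rightarrow> bool"
  obtains r :: "nat \<Rightarrow> nat" and b where "strict_mono r" "\<And>n. P (r n) = b"
proof (cases "infinite {n. P n}")
  case True
  then obtain r :: "nat \<Rightarrow> nat" where "strict_mono r" "\<forall>n. r n \<in> {n. P n}"
    using infinite_enumerate by blast
  then show thesis
    by (intro that[of r True]) auto
next
  case False
  then have "infinite {n. \<not> P n}"
    by (simp add: Collect_neg_eq finite_compl)
  then obtain r :: "nat \<Rightarrow> nat" where "strict_mono r" "\<forall>n. r n \<in> {n. \<not> P n}"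
    using infinite_enumerate by blast
  then show thesis
    by (intro that[of r False]) auto
qed

text \<open>Three successive extractions: the cut points converge to some \<open>c\<close>, the
  values at \<open>c\<close> become constant, and the parts outside \<open>unit_ivl\<close>
  stabilise at every coordinate.\<close>

lemma example_carrier_convergent_subsequence:
  fixes f :: "nat \<Rightarrow> real \<Rightarrow> bool"
  assumes f: "\<And>n. f n \<in> example_carrier"
  obtains r :: "nat \<Rightarrow> nat" and l where "strict_mono r" "(f \<circ> r) \<longlonglongrightarrow> l"
proof -
  have "\<exists>s. s \<in> {0..1} \<and> (\<forall>x\<in>unit_ivl. (s < x \<longrightarrow> f n x) \<and> (x < s \<longrightarrow> \<not> f n x))" for n
    using example_carrier_cut[OF f] by (metis atLeastAtMost_iff)
  then obtain s :: "nat \<Rightarrow> real" where s: "\<And>n. s n \<in> {0..1}"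
    and cut: "\<And>n x. x \<in> unit_ivl \<Longrightarrow> (s n < x \<longrightarrow> f n x) \<and> (x < s n \<longrightarrow> \<not> f n x)"
    by metis
  obtain c r1 where r1: "strict_mono r1" "(s \<circ> r1) \<longlonglongrightarrow> c"
    using compact_Icc[of 0 "1::real"] s unfolding compact_def by metis
  \<comment> \<open>At points of \<open>unit_ivl\<close> other than \<open>c\<close>, convergence of
    the cut points decides the value eventually; at \<open>c\<close> it does not, so that coordinate
    is made constant.\<close>
  obtain r2 :: "nat \<Rightarrow> nat" and b where r2: "strict_mono r2" "\<And>n. f (r1 (r2 n)) c = b"
    using constant_subsequence[of "\<lambda>n. f (r1 n) c"] by blast
  define h where "h n = f (r1 (r2 n))" for n
  have lim: "(\<lambda>n. s (r1 (r2 n))) \<longlonglongrightarrow> c"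
    using LIMSEQ_subseq_LIMSEQ[OF r1(2) r2(1)] by (simp add: o_def)
  have inner: "\<exists>b. \<forall>\<^sub>F n in sequentially. h n x = b" if x: "x \<in> unit_ivl" for x
  proof -
    consider "x = c" | "x < c" | "c < x"
      by linarith
    then show ?thesis
    proof cases
      case 1
      then show ?thesis
        using r2(2) by (auto simp: h_def)
    next
      case 2
      have "\<forall>\<^sub>F n in sequentially. h n x = False"
        using order_tendstoD(1)[OF lim 2] by eventually_elim (use cut[OF x] in \<open>auto simp: h_def\<close>)
      then show ?thesis
        by blast
    next
      case 3
      have "\<forall>\<^sub>F n in sequentially. h n x = True"
        using order_tendstoD(2)[OF lim 3] by eventually_elim (use cut[OF x] in \<open>auto simp: h_def\<close>)
      then show ?thesis
        by blast
    qed
  qed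
  \<comment> \<open>Either one outside point is true infinitely often, and along those indices the
    outside part is its indicator, or each outside coordinate is true finitely often and the outside
    parts tend to infinity.\<close>
  obtain r3 :: "nat \<Rightarrow> nat" where r3: "strict_mono r3"
    and outer: "\<And>x. x \<notin> unit_ivl \<Longrightarrow> \<exists>b. \<forall>\<^sub>F n in sequentially. h (r3 n) x = b"
  proof (cases "\<exists>a. a \<notin> unit_ivl \<and> infinite {n. h n a}")
    case True
    then obtain a where a: "a \<notin> unit_ivl" "infinite {n. h n a}"
      by blast
    then obtain r :: "nat \<Rightarrow> nat" where r: "strict_mono r" "\<And>n. h (r n) a"
      using infinite_enumerate[OF a(2)] by auto
    have "h (r n) x = (x = a)" if "x \<notin> unit_ivl" for n x
      using that a(1) r(2)[of n] f[of "r1 (r2 (r n))"] unfolding h_def example_carrier_def by blast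
    then have "\<forall>\<^sub>F n in sequentially. h (r n) x = (x = a)" if "x \<notin> unit_ivl" for x
      using that by simp
    with r(1) show thesis
      by (intro that[of r]) blast+
  next
    case False
    have "\<forall>\<^sub>F n in sequentially. h (id n) x = False" if "x \<notin> unit_ivl" for x
      using False that by (auto simp: eventually_cofinite simp flip: cofinite_eq_sequentially)
    then show thesis
      by (intro that[of id] strict_mono_id) blast+
  qed
  have "\<exists>b. \<forall>\<^sub>F n in sequentially. h (r3 n) x = b" for x
  proof (cases "x \<in> unit_ivl")
    case True
    then obtain b where "\<forall>\<^sub>F n in sequentially. h n x = b"
      using inner by blast
    then show ?thesis
      by (intro exI[of _ b] eventually_compose_filterlim[OF _ filterlim_subseq[OF r3]])
  qed (rule outer)
  then obtain l where "\<And>x. \<forall>\<^sub>F n in sequentially. h (r3 n) x = l x"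
    by metis
  then have "(f \<circ> (r1 \<circ> r2 \<circ> r3)) \<longlonglongrightarrow> l"
    by (simp add: tendsto_bool_fun_iff h_def)
  moreover have "strict_mono (r1 \<circ> r2 \<circ> r3)"
    using r1(1) r2(1) r3 by (intro strict_mono_o)
  ultimately show thesis
    by (rule that[rotated])
qed

section \<open>Sequences of integers in the Cech-Stone compactification\<close>

text \<open>A 0-1 function on the integers that alternates along \<open>r\<close> is one of the
  coordinates of the cube, so convergence would make an alternating real sequence converge.\<close>

lemma beta_omega_no_convergent_subsequence:
  assumes r: "strict_mono r"
  shows "\<not> limitin beta_omega (evaluation_map (discrete_topology UNIV) \<circ> r) p sequentially"
proof
  let ?D = "discrete_topology (UNIV :: nat set)"
  assume lim: "limitin beta_omega (evaluation_map ?D \<circ> r) p sequentially"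
  \<comment> \<open>Since \<open>r\<close> is injective, \<open>u (r k)\<close> is 1 exactly for
    even \<open>k\<close>.\<close>
  define u :: "nat \<Rightarrow> real" where "u n = (if n \<in> r ` {k. even k} then 1 else 0)" for n
  have u: "u \<in> unit_interval_maps ?D"
    by (auto simp: unit_interval_maps_def u_def extensional_def)
  have "continuous_map beta_omega (top_of_set {0..1}) (\<lambda>q. q u)"
    unfolding beta_omega_def cech_stone_def evaluation_cube_def
    using u by (intro continuous_map_from_subtopology continuous_map_product_projection)
  then have "limitin (top_of_set {0..1}) ((\<lambda>q. q u) \<circ> (evaluation_map ?D \<circ> r)) (p u) sequentially"
    using lim by (rule continuous_map_limit)
  moreover have "(\<lambda>q. q u) \<circ> (evaluation_map ?D \<circ> r) = (\<lambda>k. if even k then 1 else 0)"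
  proof
    fix k
    have "r k \<in> r ` {k. even k} \<longleftrightarrow> even k"
      using strict_mono_eq[OF r] by auto
    then show "((\<lambda>q. q u) \<circ> (evaluation_map ?D \<circ> r)) k = (if even k then 1 else 0)"
      using u by (simp add: evaluation_map_def u_def)
  qed
  ultimately have L: "(\<lambda>k::nat. if even k then 1 else 0 :: real) \<longlonglongrightarrow> p u"
    by (simp add: limitin_subtopology)
  have "strict_mono (\<lambda>n::nat. 2 * n)" "strict_mono (\<lambda>n::nat. 2 * n + 1)"
    by (auto intro: strict_monoI)
  from this[THEN LIMSEQ_subseq_LIMSEQ[OF L]] have "p u = 1" "p u = 0"
    by (auto simp: o_def LIMSEQ_const_iff)
  then show False
    by simp
qed

lemma evaluation_map_in_cech_stone:
  assumes "x \<in> topspace X"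
  shows "evaluation_map X x \<in> topspace (cech_stone X)"
proof -
  have "f z \<in> {0..1}" if "f \<in> unit_interval_maps X" "z \<in> topspace X" for f z
    using that by (auto simp: unit_interval_maps_def continuous_map_def Pi_iff)
  then have "evaluation_map X ` topspace X \<subseteq> topspace (evaluation_cube X)"
    by (simp add: image_subset_iff evaluation_map_def evaluation_cube_def PiE_iff)
  then have "evaluation_map X ` topspace X \<subseteq> evaluation_cube X closure_of evaluation_map X ` topspace X"
    by (rule closure_of_subset)
  then show ?thesis
    using assms \<open>_ \<subseteq> topspace (evaluation_cube X)\<close> unfolding cech_stone_def topspace_subtopology by blast
qed

text \<open>A closed subspace of a product of compact intervals.\<close>

lemma compact_space_cech_stone: "compact_space (cech_stone X)"
proof -
  have "compact_space (evaluation_cube X)"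
    unfolding evaluation_cube_def by (simp add: compact_space_product_topology compact_space_subtopology)
  then show ?thesis
    unfolding cech_stone_def by (simp add: closedin_compact_space compact_space_subtopology)
qed

text \<open>The integers are pulled back to \<open>S\<close> along the homeomorphism, a convergent
  subsequence is extracted there, and its limit is pushed forward to
  \<open>beta_omega\<close>.\<close>

lemma no_beta_omega_example: "\<not> contains_copy_of (top_of_set example_carrier) beta_omega"
proof
  let ?D = "discrete_topology (UNIV :: nat set)"
  assume "contains_copy_of (top_of_set example_carrier) beta_omega"
  then obtain S where S: "S \<subseteq> example_carrier"
      "subtopology (top_of_set example_carrier) S homeomorphic_space beta_omega"
    unfolding contains_copy_of_def by auto
  then have hom: "top_of_set S homeomorphic_space beta_omega"
    by (simp add: subtopology_subtopology Int_absorb1)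
  then obtain g h where gh: "homeomorphic_maps (top_of_set S) beta_omega g h"
    unfolding homeomorphic_space_def by blast
  have "compact_space (top_of_set S)"
    using hom compact_space_cech_stone homeomorphic_compact_space beta_omega_def by metis
  then have "compactin (top_of_set UNIV) S"
    by (simp add: compact_space_subtopology compact_space_def compactin_subtopology)
  \<comment> \<open>A compact subset of a Hausdorff space is closed, which keeps the limit of the
    subsequence in \<open>S\<close>, where \<open>g\<close> is continuous.\<close>
  then have closed: "closed S"
    using Hausdorff_top_of_set[of "UNIV :: (real \<Rightarrow> bool) set"]
    by (metis closed_closedin compactin_imp_closedin subtopology_UNIV)
  define e where "e = evaluation_map ?D"
  have e: "e n \<in> topspace beta_omega" for n
    unfolding e_def beta_omega_def by (rule evaluation_map_in_cech_stone) simp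
  have he: "h (e n) \<in> S" "g (h (e n)) = e n" for n
    using gh e[of n] by (auto simp: homeomorphic_maps_def continuous_map_def Pi_iff)
  obtain r l where r: "strict_mono r" and l: "((\<lambda>n. h (e n)) \<circ> r) \<longlonglongrightarrow> l"
    using example_carrier_convergent_subsequence[of "\<lambda>n. h (e n)"] he(1) S(1) by blast
  have "l \<in> S"
    using l he(1) by (intro Lim_in_closed_set[OF closed _ _ l]) auto
  then have "limitin (top_of_set S) ((\<lambda>n. h (e n)) \<circ> r) l sequentially"
    using l he(1) by (simp add: limitin_subtopology)
  then have "limitin beta_omega (g \<circ> ((\<lambda>n. h (e n)) \<circ> r)) (g l) sequentially"
    using gh unfolding homeomorphic_maps_def by (intro continuous_map_limit) auto
  moreover have "g \<circ> ((\<lambda>n. h (e n)) \<circ> r) = e \<circ> r"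
    using he(2) by auto
  ultimately show False
    using beta_omega_no_convergent_subsequence[OF r] unfolding e_def by metis
qed

theorem proposition1p3:
  shows "\<exists>X :: (real \<Rightarrow> bool) topology.
           topspace X \<noteq> {} \<and>
           without_isolated_points X \<and>
           compact_space X \<and>
           zero_dimensional_space X \<and>
           Hausdorff_space X \<and>
           two_disjoint_copies_property X \<and>
           \<not> locally_homogeneous_space X \<and>
           \<not> contains_copy_of X beta_omega \<and>
           \<not> contains_copy_of X cantor_set"
proof (intro exI conjI)
  have "(\<lambda>_. False) \<in> example_carrier"
    by (simp add: example_carrier_def)
  then show "topspace (top_of_set example_carrier) \<noteq> {}"
    by auto
qed (rule without_isolated_points_example compact_space_example zero_dimensional_top_of_set
    Hausdorff_top_of_set two_disjoint_copies_example not_locally_homogeneous_example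
    no_beta_omega_example no_cantor_set_example)+

end
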